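(* For every integer $r\ge 1$, the $r$-dimensional Beneš network $BN(r)$ satisfies $\operatorname{gp}(BN(r))=2^{r+1}$.
   Context: The $r$-dimensional butterfly network has vertices $\langle w,i\rangle$ with $w\in\{0,1\}^r$ and level $i\in\{0,1,\ldots,r\}$; vertices $\langle w,i-1\rangle$ and $\langle w',i\rangle$ ($1\le i\le r$) are adjacent iff $w=w'$ or $w$ and $w'$ differ exactly in the bit in position $i$, and there are no other edges. The $r$-dimensional Beneš network $BN(r)$ consists of two back-to-back $r$-dimensional butterflies, merged along their level $r$. Explicitly, $BN(r)$ has vertices $\langle w,i\rangle$ with $w\in\{0,1\}^r$ and $i\in\{0,1,\ldots,2r\}$; for $1\le i\le 2r$, the vertices $\langle w,i-1\rangle$ and $\langle w',i\rangle$ are adjacent iff $w=w'$ or $w$ and $w'$ differ exactly in the bit in position $b(i)$, where $b(i)=i$ if $i\le r$ and $b(i)=2r+1-i$ if $i>r$; there are no other edges. A geodesic of a graph is a shortest path. A set $S$ of vertices of a graph $G$ is a general position set if no three distinct vertices of $S$ lie on a common geodesic of $G$. The general position number $\operatorname{gp}(G)$ is the maximum cardinality of a general position set of $G$. *)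

theory Defs
  imports "Graph_Theory.Pair_Digraph"
begin

section \<open>General position sets\<close>

text \<open>
  Undirected simple graphs are symmetric, loop-free digraphs without parallel arcs
  (locales \<^locale>\<open>graph\<close> and \<^locale>\<open>pair_graph\<close>).
  A path is a walk without repeated vertices, given by its start vertex, the list of its
  arcs and its end vertex; its length is the number of its arcs.
\<close>

definition geodesic :: "('a, 'b) pre_digraph \<Rightarrow> 'a \<Rightarrow> 'b awalk \<Rightarrow> 'a \<Rightarrow> bool" where
  "geodesic G u p v \<longleftrightarrow>
     pre_digraph.apath G u p v \<and> (\<forall>q. pre_digraph.apath G u q v \<longrightarrow> length p \<le> length q)"

definition general_position :: "('a, 'b) pre_digraph \<Rightarrow> 'a set \<Rightarrow> bool" where
  "general_position G S \<longleftrightarrow> S \<subseteq> verts G \<and>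
     \<not> (\<exists>x\<in>S. \<exists>y\<in>S. \<exists>z\<in>S. x \<noteq> y \<and> x \<noteq> z \<and> y \<noteq> z \<and>
          (\<exists>u p v. geodesic G u p v \<and> {x, y, z} \<subseteq> set (pre_digraph.awalk_verts G u p)))"

text \<open>For finite \<open>G\<close> the maximum below is over a finite nonempty set.\<close>

definition gp :: "('a, 'b) pre_digraph \<Rightarrow> nat" where
  "gp G = Max {card S | S. general_position G S}"


section \<open>Benes networks\<close>

text \<open>
  Words are Boolean lists. Bit positions are \<open>1, \<dots>, r\<close>, so the bit in position \<open>j\<close> of \<open>w\<close>
  is \<open>w ! (j - 1)\<close>.
\<close>

definition differ_exactly_at :: "nat \<Rightarrow> bool list \<Rightarrow> bool list \<Rightarrow> bool" where
  "differ_exactly_at k w w' \<longleftrightarrow>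
     length w = length w' \<and> k \<in> {1..length w} \<and>
     (\<forall>j\<in>{1..length w}. w ! (j - 1) \<noteq> w' ! (j - 1) \<longleftrightarrow> j = k)"

definition benes_bit :: "nat \<Rightarrow> nat \<Rightarrow> nat" where
  "benes_bit r i = (if i \<le> r then i else 2 * r + 1 - i)"

definition benes_verts :: "nat \<Rightarrow> (bool list \<times> nat) set" where
  "benes_verts r = {w. length w = r} \<times> {0..2 * r}"

text \<open>The edges, each oriented from level \<open>i - 1\<close> to level \<open>i\<close>.\<close>

definition benes_up :: "nat \<Rightarrow> (bool list \<times> nat) rel" where
  "benes_up r = {((w, i - 1), (w', i)) | w w' i.
     length w = r \<and> length w' = r \<and> i \<in> {1..2 * r} \<and>
     (w = w' \<or> differ_exactly_at (benes_bit r i) w w')}"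

definition benes :: "nat \<Rightarrow> (bool list \<times> nat) pair_pre_digraph" where
  "benes r = \<lparr> pverts = benes_verts r, parcs = benes_up r \<union> (benes_up r)\<inverse> \<rparr>"

lemma finite_benes_verts: "finite (benes_verts r)"
proof -
  have "{w :: bool list. length w = r} = {w. set w \<subseteq> UNIV \<and> length w = r}" by simp
  then have "finite {w :: bool list. length w = r}"
    using finite_lists_length_eq[of "UNIV :: bool set" r] by simp
  then show ?thesis by (simp add: benes_verts_def)
qed

lemma benes_up_subset: "benes_up r \<subseteq> benes_verts r \<times> benes_verts r"
  by (auto simp: benes_up_def benes_verts_def)

lemma pair_graph_benes: "pair_graph (benes r)"
proof
  show "finite (pverts (benes r))"
    by (simp add: benes_def finite_benes_verts)
  show "finite (parcs (benes r))"
    using finite_subset[OF benes_up_subset[of r]] finite_benes_verts[of r]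
    by (simp add: benes_def)
  show "symmetric (with_proj (benes r))"
    by (auto simp: benes_def symmetric_def intro: symI)
next
  fix e assume "e \<in> parcs (benes r)"
  then have *: "e \<in> benes_up r \<union> (benes_up r)\<inverse>" by (simp add: benes_def)
  then show "fst e \<in> pverts (benes r)" "snd e \<in> pverts (benes r)"
    using benes_up_subset[of r] by (auto simp: benes_def)
  have "snd a \<noteq> snd b" if "(a, b) \<in> benes_up r" for a b
  proof -
    from that obtain i where "snd a = i - 1" "snd b = i" "i \<ge> 1"
      unfolding benes_up_def by fastforce
    then show ?thesis by linarith
  qed
  with * show "fst e \<noteq> snd e"
    by (cases e) fastforce
qed

lemma finite_general_position_cards:
  assumes "finite (verts G)"
  shows "finite {card S | S. general_position G S}" "{card S | S. general_position G S} \<noteq> {}"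
proof -
  have "{card S | S. general_position G S} \<subseteq> card ` Pow (verts G)"
    by (auto simp: general_position_def)
  then show "finite {card S | S. general_position G S}"
    using assms by (meson finite_Pow_iff finite_imageI finite_subset)
  have "general_position G {}" by (simp add: general_position_def)
  then show "{card S | S. general_position G S} \<noteq> {}" by blast
qed

end

theory Submission
  imports Defs
begin

text \<open>
  The upper bound comes from a partition of the vertices into geodesics. For a fixed word \<open>w\<close>
  the column \<open>\<langle>w, 0\<rangle>, \<dots>, \<langle>w, 2r\<rangle>\<close> is a path of length \<open>2r\<close>, and it is a geodesic because
  every edge changes the level by one (lemma \<open>between_column\<close>). A general position set therefore has
  at most two vertices in each of the \<open>2\<^sup>r\<close> columns.

  The bound is attained by the two extreme levels \<open>0\<close> and \<open>2r\<close> together. Three vertices can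
  share a geodesic only if equality holds in the triangle inequality for them, in some order; so it
  suffices that the triangle inequality is strict on the extreme levels. On level \<open>0\<close> the
  distance of two words is twice the last position in which they differ: a walk has to climb to that
  level to change the bit (lemma \<open>highest_level\<close>), and climbing no further is enough
  (lemma \<open>up_and_back\<close>). This is an ultrametric, for which the triangle inequality is strict on
  distinct points. Vertices on opposite extreme levels are at distance exactly \<open>2r\<close>
  (lemma \<open>across\<close>), and no two extreme vertices are further apart than that; so a detour through the
  opposite level is too long as well. Reflection of the levels exchanges the two sides, so the first
  of the three vertices may be taken on level \<open>0\<close>.
\<close>

section \<open>General position in terms of walk lengths\<close>

text \<open>
  This says that \<open>d(x, y) + d(y, z) = d(x, z)\<close> with all distances finite, without a distance
  function: powers of the adjacency relation record the lengths of walks.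
\<close>

definition between :: "'a rel \<Rightarrow> 'a \<Rightarrow> 'a \<Rightarrow> 'a \<Rightarrow> bool" where
  "between R x y z \<longleftrightarrow>
     (\<exists>a b. (x, y) \<in> R ^^ a \<and> (y, z) \<in> R ^^ b \<and> (\<forall>n. (x, z) \<in> R ^^ n \<longrightarrow> a + b \<le> n))"

context wf_digraph
begin

lemma awalk_imp_relpow:
  assumes "awalk u p v"
  shows "(u, v) \<in> arcs_ends G ^^ length p"
  using assms
proof (induction p arbitrary: u)
  case Nil
  then show ?case by (simp add: awalk_Nil_iff)
next
  case (Cons e p)
  then have "(u, head G e) \<in> arcs_ends G" "awalk (head G e) p v"
    by (auto simp: awalk_Cons_iff dest: in_arcs_imp_in_arcs_ends)
  then have "(u, v) \<in> arcs_ends G ^^ Suc (length p)"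
    using Cons.IH by (blast intro: relpow_Suc_I2)
  then show ?case by simp
qed

lemma relpow_imp_awalk:
  assumes "(u, v) \<in> arcs_ends G ^^ n" "u \<in> verts G"
  shows "\<exists>p. awalk u p v \<and> length p = n"
  using assms
proof (induction n arbitrary: u)
  case 0
  then show ?case by (auto simp: awalk_Nil_iff)
next
  case (Suc n)
  then obtain w where w: "(u, w) \<in> arcs_ends G" "(w, v) \<in> arcs_ends G ^^ n"
    by (meson relpow_Suc_D2)
  then obtain e where e: "e \<in> arcs G" "tail G e = u" "head G e = w"
    by (auto simp: arcs_ends_conv)
  then obtain p where "awalk w p v" "length p = n"
    using Suc.IH[OF w(2)] head_in_verts by blast
  with e have "awalk u (e # p) v \<and> length (e # p) = Suc n"
    by (auto simp: awalk_Cons_iff)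
  then show ?case by blast
qed

text \<open>
  Removing the closed parts of a walk only shortens it, so a shortest path is also a shortest walk,
  and a shortest walk repeats no vertex. Minimality can thus be tested on walks, which,
  unlike paths, may be concatenated freely.
\<close>

lemma geodesic_iff_shortest_awalk:
  "geodesic G u p v \<longleftrightarrow> awalk u p v \<and> (\<forall>n. (u, v) \<in> arcs_ends G ^^ n \<longrightarrow> length p \<le> n)"
proof
  assume geo: "geodesic G u p v"
  then have p: "awalk u p v" and min: "\<And>q. apath u q v \<Longrightarrow> length p \<le> length q"
    by (auto simp: geodesic_def apath_def)
  have "length p \<le> length q" if "awalk u q v" for q
    using that
  proof (induction rule: awalk_to_apath_induct)
    case (path q)
    then show ?case using min by (simp add: apath_def)
  next
    case (decomp q q1 q2 q3)
    have "q = q1 @ q2 @ q3"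
      using awalk_cyc_decomp_has_prop[OF decomp(1) _] decomp(2,3)
      by (auto simp: awalk_verts_conv elim!: awalk_cyc_decompE[OF _ decomp(1,3)])
    with decomp show ?case by simp
  qed
  then show "awalk u p v \<and> (\<forall>n. (u, v) \<in> arcs_ends G ^^ n \<longrightarrow> length p \<le> n)"
    using p relpow_imp_awalk awalk_hd_in_verts by blast
next
  assume *: "awalk u p v \<and> (\<forall>n. (u, v) \<in> arcs_ends G ^^ n \<longrightarrow> length p \<le> n)"
  then have p: "awalk u p v" and min: "\<And>q. awalk u q v \<Longrightarrow> length p \<le> length q"
    using awalk_imp_relpow by auto
  have "distinct (awalk_verts u p)"
  proof (rule ccontr)
    assume "\<not> distinct (awalk_verts u p)"
    then obtain q r s w where "p = q @ r @ s" "awalk u q w" "r \<noteq> []" "awalk w s v"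
      using awalk_not_distinct_decomp[OF p] by blast
    with min[of "q @ s"] show False
      by (metis add_le_cancel_left add_le_same_cancel2 awalk_appendI le_zero_eq length_0_conv
          length_append)
  qed
  with p min show "geodesic G u p v"
    by (auto simp: geodesic_def apath_def)
qed

lemma awalk_verts_relpow:
  assumes "awalk u p v" "i \<le> j" "j \<le> length p"
  shows "(awalk_verts u p ! i, awalk_verts u p ! j) \<in> arcs_ends G ^^ (j - i)"
proof -
  have step: "(awalk_verts u p ! k, awalk_verts u p ! Suc k) \<in> arcs_ends G"
    if "k < length p" for k
    using assms(1) that
  proof (induction p arbitrary: u k)
    case (Cons e p)
    then have e: "e \<in> arcs G" "tail G e = u" and p: "awalk (head G e) p v"
      by (auto simp: awalk_Cons_iff)
    have "awalk_verts (head G e) p ! 0 = head G e"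
      using awhd_of_awalk[OF p] by (simp add: hd_conv_nth)
    then show ?case
      using Cons e p in_arcs_imp_in_arcs_ends[OF e(1)] by (cases k) auto
  qed simp
  show ?thesis
    unfolding relpow_fun_conv
    by (rule exI[of _ "\<lambda>k. awalk_verts u p ! (i + k)"]) (use assms step in auto)
qed

text \<open>
  A shorter connection between two vertices of a geodesic could be spliced into it and would shorten it.
\<close>

lemma geodesic_imp_between:
  assumes geo: "geodesic G u p v" and ij: "i \<le> j" "j \<le> k" "k \<le> length p"
  shows "between (arcs_ends G) (awalk_verts u p ! i) (awalk_verts u p ! j) (awalk_verts u p ! k)"
proof -
  have p: "awalk u p v" and min: "\<And>n. (u, v) \<in> arcs_ends G ^^ n \<Longrightarrow> length p \<le> n"
    using geo by (auto simp: geodesic_iff_shortest_awalk)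
  let ?x = "\<lambda>i. awalk_verts u p ! i"
  have "cas u p v" using p by (simp add: awalk_def)
  note awhd_if_cas[OF this] awlast_if_cas[OF this]
  then have ends: "?x 0 = u" "?x (length p) = v"
    by (simp_all add: hd_conv_nth last_conv_nth length_awalk_verts)
  have "(j - i) + (k - j) \<le> n" if n: "(?x i, ?x k) \<in> arcs_ends G ^^ n" for n
  proof -
    have "(u, ?x i) \<in> arcs_ends G ^^ i" "(?x k, v) \<in> arcs_ends G ^^ (length p - k)"
      using awalk_verts_relpow[OF p, of 0 i] awalk_verts_relpow[OF p, of k "length p"] ij ends
      by auto
    with n have "(u, v) \<in> arcs_ends G ^^ (i + n + (length p - k))"
      by (auto simp: relpow_add)
    from min[OF this] show ?thesis using ij by simp
  qed
  moreover have "(?x i, ?x j) \<in> arcs_ends G ^^ (j - i)" "(?x j, ?x k) \<in> arcs_ends G ^^ (k - j)"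
    using awalk_verts_relpow[OF p] ij by auto
  ultimately show ?thesis
    unfolding between_def by blast
qed

lemma between_imp_geodesic:
  assumes "between (arcs_ends G) x y z" "x \<in> verts G"
  shows "\<exists>p. geodesic G x p z \<and> {x, y, z} \<subseteq> set (awalk_verts x p)"
proof -
  obtain a b where xy: "(x, y) \<in> arcs_ends G ^^ a" and yz: "(y, z) \<in> arcs_ends G ^^ b"
    and min: "\<And>n. (x, z) \<in> arcs_ends G ^^ n \<Longrightarrow> a + b \<le> n"
    using assms(1) by (auto simp: between_def)
  obtain p where p: "awalk x p y" "length p = a"
    using relpow_imp_awalk[OF xy assms(2)] by blast
  obtain q where q: "awalk y q z" "length q = b"
    using relpow_imp_awalk[OF yz] p(1) by blast
  have pq: "awalk x (p @ q) z" using p q by (intro awalk_appendI) auto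
  then have "geodesic G x (p @ q) z"
    using min p q by (auto simp: geodesic_iff_shortest_awalk)
  moreover have "x \<in> set (awalk_verts x (p @ q))"
    using pq by (rule hd_in_awalk_verts(1))
  moreover have "z \<in> set (awalk_verts x (p @ q))"
    using pq last_in_set[OF awalk_verts_non_Nil[of x "p @ q"]] unfolding awalk_conv by argo
  moreover have "y \<in> set (awalk_verts x (p @ q))"
    using set_awalk_verts_append[OF p(1) q(1)] hd_in_awalk_verts(1)[OF q(1)] by simp
  ultimately show ?thesis by blast
qed

text \<open>
  The quantifiers run over ordered triples, which absorbs the six orders in which three vertices
  can occur along a geodesic.
\<close>

lemma general_position_iff_between:
  "general_position G S \<longleftrightarrow> S \<subseteq> verts G \<and>
     (\<forall>x\<in>S. \<forall>y\<in>S. \<forall>z\<in>S. distinct [x, y, z] \<longrightarrow> \<not> between (arcs_ends G) x y z)"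
    (is "_ \<longleftrightarrow> _ \<and> ?free")
proof -
  have "\<not> ?free"
    if geo: "geodesic G u p v" and S: "x \<in> S" "y \<in> S" "z \<in> S"
    and ne: "x \<noteq> y" "x \<noteq> z" "y \<noteq> z" and on: "{x, y, z} \<subseteq> set (awalk_verts u p)"
    for u p v x y z
  proof -
    let ?at = "\<lambda>i. awalk_verts u p ! i"
    obtain i j k where idx: "x = ?at i" "y = ?at j" "z = ?at k"
        "i \<le> length p" "j \<le> length p" "k \<le> length p"
      using on by (auto simp: in_set_conv_nth length_awalk_verts less_Suc_eq_le)
    have violated: "\<not> ?free"
      if "between (arcs_ends G) a b c" "{a, b, c} \<subseteq> S" "distinct [a, b, c]" for a b c
      using that by auto
    note violated = violated[OF geodesic_imp_between[OF geo]]
    consider "i \<le> j" "j \<le> k" | "i \<le> k" "k \<le> j" | "j \<le> i" "i \<le> k"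
      | "j \<le> k" "k \<le> i" | "k \<le> i" "i \<le> j" | "k \<le> j" "j \<le> i"
      by linarith
    then show ?thesis
    proof cases
      case 1 with idx S ne show ?thesis by (intro violated[of i j k]) auto
    next
      case 2 with idx S ne show ?thesis by (intro violated[of i k j]) auto
    next
      case 3 with idx S ne show ?thesis by (intro violated[of j i k]) auto
    next
      case 4 with idx S ne show ?thesis by (intro violated[of j k i]) auto
    next
      case 5 with idx S ne show ?thesis by (intro violated[of k i j]) auto
    next
      case 6 with idx S ne show ?thesis by (intro violated[of k j i]) auto
    qed
  qed
  then have backward: "general_position G S" if ?free "S \<subseteq> verts G"
    unfolding general_position_def using that by metis
  have forward: ?free if gp: "general_position G S"
  proof (intro ballI impI notI)
    fix x y z
    assume S: "x \<in> S" "y \<in> S" "z \<in> S" "distinct [x, y, z]" and "between (arcs_ends G) x y z"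
    moreover have "x \<in> verts G" using gp S(1) by (auto simp: general_position_def)
    ultimately obtain p where p: "geodesic G x p z" "{x, y, z} \<subseteq> set (awalk_verts x p)"
      using between_imp_geodesic by blast
    moreover have "x \<noteq> y" "x \<noteq> z" "y \<noteq> z" using S(4) by auto
    ultimately show False
      using S(1-3) gp unfolding general_position_def by metis
  qed
  have subset: "S \<subseteq> verts G" if "general_position G S"
    using that by (simp add: general_position_def)
  show ?thesis
  proof
    assume gp: "general_position G S"
    show "S \<subseteq> verts G \<and> ?free" using subset[OF gp] forward[OF gp] by (rule conjI)
  next
    assume *: "S \<subseteq> verts G \<and> ?free"
    show "general_position G S" by (rule backward[OF conjunct2[OF *] conjunct1[OF *]])
  qed
qed

end

section \<open>Walks in Benes networks\<close>

lemma equal_or_differ_exactly_at_iff: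
  assumes "length w = length v" "k \<in> {1..length w}"
  shows "w = v \<or> differ_exactly_at k w v \<longleftrightarrow> (\<forall>l<length w. l \<noteq> k - 1 \<longrightarrow> w ! l = v ! l)"
proof
  assume R: "\<forall>l<length w. l \<noteq> k - 1 \<longrightarrow> w ! l = v ! l"
  show "w = v \<or> differ_exactly_at k w v"
  proof (cases "w ! (k - 1) = v ! (k - 1)")
    case True
    with R assms have "w = v" by (intro nth_equalityI) auto
    then show ?thesis ..
  next
    case False
    have "w ! (j - 1) \<noteq> v ! (j - 1) \<longleftrightarrow> j = k" if j: "j \<in> {1..length w}" for j
    proof (cases "j = k")
      case False
      with j assms(2) have "j - 1 < length w" "j - 1 \<noteq> k - 1" by auto
      with R False show ?thesis by blast
    qed (use False in simp)
    with assms have "differ_exactly_at k w v"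
      unfolding differ_exactly_at_def by blast
    then show ?thesis ..
  qed
next
  assume "w = v \<or> differ_exactly_at k w v"
  then show "\<forall>l<length w. l \<noteq> k - 1 \<longrightarrow> w ! l = v ! l"
  proof
    assume d: "differ_exactly_at k w v"
    show ?thesis
    proof (intro allI impI)
      fix l assume "l < length w" "l \<noteq> k - 1"
      then have "l + 1 \<in> {1..length w}" "l + 1 \<noteq> k" by auto
      with d show "w ! l = v ! l"
        unfolding differ_exactly_at_def by (metis add_diff_cancel_right')
    qed
  qed simp
qed

text \<open>
  Equality and a difference in exactly one place merge into a single condition: the words agree in
  all other places. Places are counted from \<open>0\<close> here, bits from \<open>1\<close>.
\<close>

lemma benes_up_iff:
  "((w, i), (v, j)) \<in> benes_up r \<longleftrightarrow>
     length w = r \<and> length v = r \<and> j = Suc i \<and> i < 2 * r \<and>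
     (\<forall>l<r. l \<noteq> benes_bit r j - 1 \<longrightarrow> w ! l = v ! l)"
proof -
  have "((w, i), (v, j)) \<in> benes_up r \<longleftrightarrow>
     length w = r \<and> length v = r \<and> j = Suc i \<and> i < 2 * r \<and>
     (w = v \<or> differ_exactly_at (benes_bit r j) w v)"
    by (auto simp: benes_up_def)
  moreover have "benes_bit r (Suc i) \<in> {1..r}" if "i < 2 * r"
    using that by (auto simp: benes_bit_def)
  ultimately show ?thesis
    using equal_or_differ_exactly_at_iff[of w v "benes_bit r j"] by auto
qed

abbreviation benes_arcs :: "nat \<Rightarrow> (bool list \<times> nat) rel" where
  "benes_arcs r \<equiv> parcs (benes r)"

lemma benes_arcs_iff:
  "(x, y) \<in> benes_arcs r \<longleftrightarrow> (x, y) \<in> benes_up r \<or> (y, x) \<in> benes_up r"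
  by (simp add: benes_def)

lemma sym_relpow_benes: "(x, y) \<in> benes_arcs r ^^ n \<Longrightarrow> (y, x) \<in> benes_arcs r ^^ n"
proof (induction n arbitrary: y)
  case (Suc n)
  then obtain z where z: "(x, z) \<in> benes_arcs r ^^ n" "(z, y) \<in> benes_arcs r" by auto
  then have "(y, z) \<in> benes_arcs r" by (auto simp: benes_arcs_iff)
  with Suc.IH[OF z(1)] show ?case by (intro relpow_Suc_I2)
qed simp

definition mirror :: "nat \<Rightarrow> bool list \<times> nat \<Rightarrow> bool list \<times> nat" where
  "mirror r x = (fst x, 2 * r - snd x)"

lemma mirror_up: "(x, y) \<in> benes_up r \<Longrightarrow> (mirror r y, mirror r x) \<in> benes_up r"
  by (cases x; cases y)
    (auto simp: mirror_def benes_up_iff benes_bit_def Suc_diff_Suc split: if_splits)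

lemma mirror_relpow:
  "(x, y) \<in> benes_arcs r ^^ n \<Longrightarrow> (mirror r x, mirror r y) \<in> benes_arcs r ^^ n"
proof (induction n arbitrary: y)
  case (Suc n)
  then obtain z where "(x, z) \<in> benes_arcs r ^^ n" "(z, y) \<in> benes_arcs r" by auto
  then have "(mirror r x, mirror r z) \<in> benes_arcs r ^^ n"
    "(mirror r z, mirror r y) \<in> benes_arcs r"
    using Suc.IH by (auto simp only: benes_arcs_iff dest: mirror_up)
  then show ?case by (rule relpow_Suc_I)
qed simp

lemma relpow_benes_level:
  "((w, i), (v, j)) \<in> benes_arcs r ^^ n \<Longrightarrow> j \<le> i + n"
proof (induction n arbitrary: v j)
  case (Suc n)
  then obtain u k where "((w, i), (u, k)) \<in> benes_arcs r ^^ n" "((u, k), (v, j)) \<in> benes_arcs r"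
    by auto
  with Suc.IH show ?case by (fastforce simp: benes_arcs_iff benes_up_iff)
qed simp

text \<open>
  On the way up to level \<open>m\<close> each of the bits \<open>1, \<dots>, m\<close> may be set at will, so every word that agrees
  with the start beyond these bits is reached without a detour.
\<close>

lemma ascend:
  assumes "length w = r" "length v = r" "m \<le> r" "\<And>l. m \<le> l \<Longrightarrow> l < r \<Longrightarrow> w ! l = v ! l"
  shows "((w, 0), (v, m)) \<in> benes_arcs r ^^ m"
  using assms
proof (induction m arbitrary: v)
  case 0
  then have "w = v" by (auto intro: nth_equalityI)
  then show ?case by simp
next
  case (Suc m)
  (* The first m steps produce v except for one bit, which the last step corrects. *)
  let ?u = "v[m := w ! m]"
  have "((w, 0), (?u, m)) \<in> benes_arcs r ^^ m"
    using Suc.prems by (intro Suc.IH) (auto simp: nth_list_update le_eq_less_or_eq[of m])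
  moreover have "((?u, m), (v, Suc m)) \<in> benes_arcs r"
    using Suc.prems by (auto simp: benes_arcs_iff benes_up_iff benes_bit_def)
  ultimately show ?case by auto
qed

lemma up_and_back:
  assumes "length w = r" "length v = r" "m \<le> r" "\<And>l. m \<le> l \<Longrightarrow> l < r \<Longrightarrow> w ! l = v ! l"
  shows "((w, 0), (v, 0)) \<in> benes_arcs r ^^ (2 * m)"
proof -
  have "((w, 0), (v, m)) \<in> benes_arcs r ^^ m" using assms by (rule ascend)
  moreover have "((v, m), (v, 0)) \<in> benes_arcs r ^^ m"
    using assms by (intro sym_relpow_benes[OF ascend]) auto
  ultimately have "((w, 0), (v, 0)) \<in> benes_arcs r ^^ (m + m)"
    by (auto simp: relpow_add)
  then show ?thesis by (simp add: mult_2)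
qed

text \<open>
  All bits are corrected in the first butterfly, and the second one is then crossed along a column.
\<close>

lemma across:
  assumes "length w = r" "length v = r"
  shows "((w, 0), (v, 2 * r)) \<in> benes_arcs r ^^ (2 * r)"
proof -
  have "((w, 0), (v, r)) \<in> benes_arcs r ^^ r" using assms by (intro ascend) auto
  moreover have "((v, r), (v, 2 * r)) \<in> benes_arcs r ^^ r"
    using mirror_relpow[OF sym_relpow_benes[OF ascend[of v r v r]]] assms
    by (simp add: mirror_def)
  ultimately have "((w, 0), (v, 2 * r)) \<in> benes_arcs r ^^ (r + r)"
    by (auto simp: relpow_add)
  then show ?thesis by (simp add: mult_2)
qed

text \<open>
  Take \<open>M\<close> to be the highest level that the walk visits. It costs \<open>M + (M - i)\<close> steps at least to
  climb from level \<open>0\<close> to \<open>M\<close> and return to \<open>i\<close>. If \<open>M < r\<close>, then the edges below level \<open>M\<close> change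
  only the bits \<open>1, \<dots>, M\<close>; if \<open>M \<ge> r\<close>, then there are no bits beyond \<open>M\<close> to agree in.
\<close>

lemma highest_level:
  assumes "((w, 0), (v, i)) \<in> benes_arcs r ^^ n"
  obtains M where "i \<le> M" "2 * M \<le> n + i" "\<And>l. M \<le> l \<Longrightarrow> l < r \<Longrightarrow> w ! l = v ! l"
proof -
  have "\<exists>M. i \<le> M \<and> 2 * M \<le> n + i \<and> (\<forall>l. M \<le> l \<longrightarrow> l < r \<longrightarrow> w ! l = v ! l)"
    using assms
  proof (induction n arbitrary: v i)
    case (Suc n)
    then obtain u k where uk: "((w, 0), (u, k)) \<in> benes_arcs r ^^ n"
      and arc: "((u, k), (v, i)) \<in> benes_arcs r" by auto
    from Suc.IH[OF uk] obtain M where M: "k \<le> M" "2 * M \<le> n + k"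
      "\<And>l. M \<le> l \<Longrightarrow> l < r \<Longrightarrow> w ! l = u ! l" by blast
    let ?M = "max M i"
    have "u ! l = v ! l" if l: "?M \<le> l" "l < r" for l
    proof -
      (* The larger of the two levels is the one that indexes the edge. *)
      have "l \<noteq> benes_bit r (max k i) - 1"
        using l M(1) arc by (auto simp: benes_arcs_iff benes_up_iff benes_bit_def)
      then show ?thesis using arc l
        by (auto simp: benes_arcs_iff benes_up_iff)
    qed
    moreover have "2 * ?M \<le> Suc n + i"
      using arc M(1,2) by (auto simp: benes_arcs_iff benes_up_iff max_def)
    ultimately show ?case using M(3) by (intro exI[of _ ?M]) auto
  qed auto
  then show thesis using that by blast
qed

section \<open>General position of the extreme levels\<close>

text \<open>
  Let \<open>x\<close>, \<open>y\<close>, \<open>z\<close> be the three vertices. If \<open>z\<close> is on the opposite level, then \<open>d(x, z) = 2r\<close>, while one of the two parts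
  crosses the network and the other is not empty. If \<open>z\<close> is on level \<open>0\<close> and only \<open>y\<close> is opposite,
  then both parts cross, but \<open>d(x, z) \<le> 2r\<close>. If all three are on level \<open>0\<close>, the
  ultrametric inequality gives the contradiction.
\<close>

lemma not_between_extremes_from_bottom:
  assumes "r \<ge> 1" "length w = r" "length v = r" "length u = r"
    and "j \<in> {0, 2 * r}" "k \<in> {0, 2 * r}" "(w, 0) \<noteq> (v, j)" "(v, j) \<noteq> (u, k)"
  shows "\<not> between (benes_arcs r) (w, 0) (v, j) (u, k)"
proof
  assume "between (benes_arcs r) (w, 0) (v, j) (u, k)"
  then obtain a b where a: "((w, 0), (v, j)) \<in> benes_arcs r ^^ a"
    and b: "((v, j), (u, k)) \<in> benes_arcs r ^^ b"
    and min: "\<And>n. ((w, 0), (u, k)) \<in> benes_arcs r ^^ n \<Longrightarrow> a + b \<le> n"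
    by (auto simp: between_def)
  have pos: "a > 0" "b > 0" using a b assms(7,8) by (auto intro: gr0I)
  have levels: "j \<le> a" "k \<le> j + b" "j \<le> k + b"
    using relpow_benes_level[OF a] relpow_benes_level[OF b]
      relpow_benes_level[OF sym_relpow_benes[OF b]] by auto
  show False
  proof (cases "k = 0")
    case False
    then have "a + b \<le> 2 * r" using min across[of w r u] assms by auto
    then show False using levels pos assms(5,6) False by auto
  next
    case k: True
    show False
    proof (cases "j = 0")
      case True
      obtain M where M: "2 * M \<le> a" "\<And>l. M \<le> l \<Longrightarrow> l < r \<Longrightarrow> w ! l = v ! l"
        using highest_level[OF a[unfolded True]] by auto
      obtain N where N: "2 * N \<le> b" "\<And>l. N \<le> l \<Longrightarrow> l < r \<Longrightarrow> v ! l = u ! l"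
        using highest_level[of v u 0 b r] b True k by auto
      (* M and N bound levels that walks reach, possibly beyond r; climbing to r is always enough. *)
      have "((w, 0), (u, 0)) \<in> benes_arcs r ^^ (2 * min r (max M N))"
        using assms M(2) N(2) by (intro up_and_back) auto
      then have "a + b \<le> 2 * min r (max M N)" using min k by blast
      then show False using M(1) N(1) pos by auto
    next
      case False
      have "a + b \<le> 2 * r" using min up_and_back[of w r u r] k assms by auto
      then show False using levels False assms(1,5) k by auto
    qed
  qed
qed

lemma between_mirror:
  assumes "snd x \<le> 2 * r" "snd z \<le> 2 * r" "between (benes_arcs r) x y z"
  shows "between (benes_arcs r) (mirror r x) (mirror r y) (mirror r z)"
proof -
  have "mirror r (mirror r x) = x" "mirror r (mirror r z) = z"
    using assms by (auto simp: mirror_def prod_eq_iff)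
  then have "(x, z) \<in> benes_arcs r ^^ n" if "(mirror r x, mirror r z) \<in> benes_arcs r ^^ n" for n
    using mirror_relpow[OF that] by simp
  then show ?thesis
    using assms(3) mirror_relpow unfolding between_def by meson
qed

definition extreme_levels :: "nat \<Rightarrow> (bool list \<times> nat) set" where
  "extreme_levels r = {w. length w = r} \<times> {0, 2 * r}"

lemma card_words: "card {w :: bool list. length w = r} = 2 ^ r"
  using card_lists_length_eq[of "UNIV :: bool set" r] by simp

lemma card_extreme_levels: "r \<ge> 1 \<Longrightarrow> card (extreme_levels r) = 2 ^ (r + 1)"
  by (simp add: extreme_levels_def card_cartesian_product card_words)

lemma wf_digraph_benes: "wf_digraph (with_proj (benes r))"
proof -
  interpret pair_graph "benes r" by (rule pair_graph_benes)
  show ?thesis by unfold_locales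
qed

lemma general_position_benes_iff:
  "general_position (with_proj (benes r)) S \<longleftrightarrow> S \<subseteq> benes_verts r \<and>
     (\<forall>x\<in>S. \<forall>y\<in>S. \<forall>z\<in>S. distinct [x, y, z] \<longrightarrow> \<not> between (benes_arcs r) x y z)"
proof -
  have "verts (with_proj (benes r)) = benes_verts r" by (simp add: benes_def)
  then show ?thesis
    by (simp only: wf_digraph.general_position_iff_between[OF wf_digraph_benes] with_proj_simps)
qed

lemma general_position_extreme_levels:
  assumes "r \<ge> 1"
  shows "general_position (with_proj (benes r)) (extreme_levels r)"
proof -
  have no_between: "\<not> between (benes_arcs r) x y z"
    if S: "x \<in> extreme_levels r" "y \<in> extreme_levels r" "z \<in> extreme_levels r"
      and ne: "x \<noteq> y" "y \<noteq> z" for x y z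
  proof -
    obtain w i v j u k where xyz: "x = (w, i)" "y = (v, j)" "z = (u, k)"
      by (metis surj_pair)
    with S have len: "length w = r" "length v = r" "length u = r"
      and ijk: "i \<in> {0, 2 * r}" "j \<in> {0, 2 * r}" "k \<in> {0, 2 * r}"
      by (auto simp: extreme_levels_def)
    note bottom = not_between_extremes_from_bottom[OF assms len]
    show ?thesis
    proof (cases "i = 0")
      case True
      with bottom[of j k] ijk ne xyz show ?thesis by simp
    next
      case False
      then have i: "i = 2 * r" using ijk by simp
      have "(w, 0) \<noteq> (v, 2 * r - j)" "(v, 2 * r - j) \<noteq> (u, 2 * r - k)"
        using ne xyz ijk i by auto
      then have "\<not> between (benes_arcs r) (w, 0) (v, 2 * r - j) (u, 2 * r - k)"
        using bottom[of "2 * r - j" "2 * r - k"] ijk by auto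
      then show ?thesis
        using between_mirror[of x r z y] ijk i xyz by (auto simp: mirror_def)
    qed
  qed
  have "extreme_levels r \<subseteq> benes_verts r"
    by (auto simp: extreme_levels_def benes_verts_def)
  then show ?thesis
    unfolding general_position_benes_iff
    by (intro conjI ballI impI no_between) auto
qed

section \<open>Columns as geodesics\<close>

lemma climb_column:
  assumes "length w = r" "i \<le> j" "j \<le> 2 * r"
  shows "((w, i), (w, j)) \<in> benes_arcs r ^^ (j - i)"
  unfolding relpow_fun_conv
  by (rule exI[of _ "\<lambda>k. (w, i + k)"])
    (use assms in \<open>auto simp: benes_arcs_iff benes_up_iff\<close>)

lemma between_column:
  assumes "length w = r" "i \<le> j" "j \<le> k" "k \<le> 2 * r"
  shows "between (benes_arcs r) (w, i) (w, j) (w, k)"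
proof -
  have "(j - i) + (k - j) \<le> n" if "((w, i), (w, k)) \<in> benes_arcs r ^^ n" for n
    using relpow_benes_level[OF that] assms by simp
  moreover have "((w, i), (w, j)) \<in> benes_arcs r ^^ (j - i)"
    "((w, j), (w, k)) \<in> benes_arcs r ^^ (k - j)"
    using assms by (auto intro: climb_column)
  ultimately show ?thesis unfolding between_def by blast
qed

lemma three_increasing:
  fixes A :: "nat set"
  assumes "finite A" "card A > 2"
  obtains i j k where "i \<in> A" "j \<in> A" "k \<in> A" "i < j" "j < k"
proof -
  let ?xs = "sorted_list_of_set A"
  have len: "length ?xs > 2" using assms by simp
  have "\<And>m. m < length ?xs \<Longrightarrow> ?xs ! m \<in> A"
    using assms(1) by (metis nth_mem set_sorted_list_of_set)
  moreover have "?xs ! 0 < ?xs ! 1" "?xs ! 1 < ?xs ! 2"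
    using len strict_sorted_list_of_set[of A] by (auto simp: sorted_wrt_iff_nth_less)
  ultimately show thesis using that len by (meson less_trans one_less_numeral_iff pos2 semiring_norm(76))
qed

lemma card_general_position_le:
  assumes gp: "general_position (with_proj (benes r)) S"
  shows "card S \<le> 2 ^ (r + 1)"
proof -
  have sub: "S \<subseteq> benes_verts r"
    and free: "\<And>x y z. x \<in> S \<Longrightarrow> y \<in> S \<Longrightarrow> z \<in> S \<Longrightarrow> distinct [x, y, z] \<Longrightarrow>
       \<not> between (benes_arcs r) x y z"
    using gp unfolding general_position_benes_iff by blast+
  let ?W = "{w :: bool list. length w = r}" and ?L = "\<lambda>w. {i. (w, i) \<in> S}"
  have fin: "finite (?L w)" for w
    using sub by (auto simp: benes_verts_def intro: finite_subset[of _ "{0..2 * r}"])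
  have "card (?L w) \<le> 2" for w
  proof (rule ccontr)
    assume "\<not> card (?L w) \<le> 2"
    then obtain i j k where "(w, i) \<in> S" "(w, j) \<in> S" "(w, k) \<in> S" "i < j" "j < k"
      using three_increasing[OF fin] by (metis mem_Collect_eq not_le)
    with free[of "(w, i)" "(w, j)" "(w, k)"] between_column[of w r i j k] sub show False
      by (auto simp: benes_verts_def)
  qed
  moreover have "S = Sigma ?W ?L" using sub by (auto simp: benes_verts_def)
  moreover have "finite ?W" by (rule card_ge_0_finite) (simp add: card_words)
  ultimately have "card S \<le> (\<Sum>w\<in>?W. 2)"
    using fin by (metis (no_types, lifting) card_SigmaI sum_mono)
  then show ?thesis by (simp add: card_words)
qed

section \<open>The general position number\<close>

theorem theorem5p1:
  fixes r :: nat
  assumes "r \<ge> 1"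
  shows "gp (with_proj (benes r)) = 2 ^ (r + 1)"
  unfolding gp_def
proof (rule Max_eqI)
  show "finite {card S | S. general_position (with_proj (benes r)) S}"
    by (rule finite_general_position_cards) (simp add: benes_def finite_benes_verts)
  show "2 ^ (r + 1) \<in> {card S | S. general_position (with_proj (benes r)) S}"
    using general_position_extreme_levels[OF assms] card_extreme_levels[OF assms]
    by (metis (mono_tags, lifting) mem_Collect_eq)
qed (auto dest: card_general_position_le)

end
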